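(* Assume that $\Lambda \subseteq \mathbb{C}\simeq\mathbb{R}^2$ is a sampling set for $\mathcal{F}^2$ and that $\tau>0$ is large enough. Then $\{\pi(\lambda)h_0 : \lambda\in\Lambda,\ \pi|\lambda|^2\le n+\sqrt{n}\,\tau\}$ is a frame for $V_n=\mathrm{span}\,\{h_k : k=0,\dots,n\}$ with bounds independent of $n$; that is, there exist constants $A,B>0$ and $n_0$ such that for all $n\ge n_0$ $$A\|f\|_2^2\le \sum_{\lambda\in\Lambda:\ \pi|\lambda|^2\le n+\sqrt{n}\,\tau}|\langle f,\pi(\lambda)h_0\rangle|^2\le B\|f\|_2^2\qquad\text{for all } f\in V_n .$$
   Context: The Fock space $\mathcal{F}^2$ is the Hilbert space of all entire functions $f$ with finite norm $\|f\|_{\mathcal{F}^2} = \left(\int_{\mathbb{C}} |f(z)|^2 e^{-\pi |z|^2}\, dm(z)\right)^{1/2}$, where $dm$ is Lebesgue measure on $\mathbb{C}$. A set $\Lambda \subseteq \mathbb{C}$ is a sampling set for $\mathcal{F}^2$ if there are constants $A',B'>0$ such that $A'\|f\|_{\mathcal{F}^2}^2 \le \sum_{\lambda \in \Lambda} |f(\lambda)|^2 e^{-\pi|\lambda|^2} \le B' \|f\|_{\mathcal{F}^2}^2$ for all $f \in \mathcal{F}^2$. For $z=(x,\xi)\in\mathbb{R}^2$ (identified with $x+i\xi\in\mathbb{C}$) and a function $g$ on $\mathbb{R}$, the time-frequency shift is $(\pi(z)g)(t)=e^{2\pi i\xi t}g(t-x)$, $t\in\mathbb{R}$. In the condition $\pi|\lambda|^2\le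 n+\sqrt n\,\tau$ the symbol $\pi$ is the number. The $L^2(\mathbb{R})$-normalized Hermite functions are $h_k(t)=c_k e^{\pi t^2}\frac{d^k}{dt^k}(e^{-2\pi t^2})$ with $c_k$ chosen such that $\|h_k\|_2=1$; in particular $h_0(t)=2^{1/4}e^{-\pi t^2}$. The inner product $\langle\cdot,\cdot\rangle$ and norm $\|\cdot\|_2$ are those of $L^2(\mathbb{R})$. The vectors $\pi(\lambda)h_0$ need not belong to $V_n$; "frame for $V_n$" means the displayed inequalities. *)

theory Defs
  imports "HOL-Analysis.Analysis" "HOL-Library.Function_Algebras"
begin

text \<open>Fock space. An entire function is continuous, so integrability of the weighted square
  modulus is exactly finiteness of the norm.\<close>

definition fock_space :: "(complex \<Rightarrow> complex) set" where
  "fock_space = {f. f holomorphic_on UNIV \<and>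
     integrable lborel (\<lambda>z. (cmod (f z))\<^sup>2 * exp (- pi * (cmod z)\<^sup>2))}"

definition fock_norm :: "(complex \<Rightarrow> complex) \<Rightarrow> real" where
  "fock_norm f = sqrt (\<integral>z. (cmod (f z))\<^sup>2 * exp (- pi * (cmod z)\<^sup>2) \<partial>lborel)"

text \<open>The \<^term>\<open>infsum\<close> of a non-summable family is 0, so finiteness of the sampling sum has to be
  required separately; the same applies to \<open>frame_with_bounds\<close> below.\<close>

definition fock_sampling_set :: "complex set \<Rightarrow> bool" where
  "fock_sampling_set \<Lambda> \<longleftrightarrow> (\<exists>A>0. \<exists>B>0. \<forall>f\<in>fock_space.
     (\<lambda>z. (cmod (f z))\<^sup>2 * exp (- pi * (cmod z)\<^sup>2)) summable_on \<Lambda> \<and>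
     A * (fock_norm f)\<^sup>2 \<le> (\<Sum>\<^sub>\<infinity>z\<in>\<Lambda>. (cmod (f z))\<^sup>2 * exp (- pi * (cmod z)\<^sup>2)) \<and>
     (\<Sum>\<^sub>\<infinity>z\<in>\<Lambda>. (cmod (f z))\<^sup>2 * exp (- pi * (cmod z)\<^sup>2)) \<le> B * (fock_norm f)\<^sup>2)"

definition L2_inner :: "(real \<Rightarrow> complex) \<Rightarrow> (real \<Rightarrow> complex) \<Rightarrow> complex" where
  "L2_inner f g = (\<integral>t. f t * cnj (g t) \<partial>lborel)"

definition L2_norm :: "(real \<Rightarrow> complex) \<Rightarrow> real" where
  "L2_norm f = sqrt (\<integral>t. (cmod (f t))\<^sup>2 \<partial>lborel)"

text \<open>The point \<open>(x, \<xi>)\<close> of the time-frequency plane is the complex number \<open>x + i\<xi>\<close>.\<close>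

definition tf_shift :: "complex \<Rightarrow> (real \<Rightarrow> complex) \<Rightarrow> real \<Rightarrow> complex" where
  "tf_shift z g = (\<lambda>t. exp (2 * complex_of_real pi * \<i> * complex_of_real (Im z) * complex_of_real t)
                     * g (t - Re z))"

definition hermite_unnormalized :: "nat \<Rightarrow> real \<Rightarrow> complex" where
  "hermite_unnormalized k = (\<lambda>t. complex_of_real
     (exp (pi * t\<^sup>2) * (deriv ^^ k) (\<lambda>s::real. exp (- 2 * pi * s\<^sup>2)) t))"

text \<open>The normalizing constant is only determined up to sign; the positive choice is the one
  giving \<open>h\<^sub>0(t) = 2\<^sup>1\<^sup>/\<^sup>4 exp (- \<pi> t\<^sup>2)\<close>.\<close>

definition hermite :: "nat \<Rightarrow> real \<Rightarrow> complex" where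
  "hermite k = (\<lambda>t. complex_of_real (1 / L2_norm (hermite_unnormalized k)) * hermite_unnormalized k t)"

text \<open>The library's plain \<^term>\<open>span\<close> is the real one, whereas \<open>V\<^sub>n\<close> is a complex linear span. Here
  functions are added pointwise and scaled by complex numbers.\<close>

interpretation complex_fun: vector_space "\<lambda>(c::complex) (f::real \<Rightarrow> complex) t. c * f t"
  by unfold_locales (auto simp: fun_eq_iff algebra_simps)

definition hermite_space :: "nat \<Rightarrow> (real \<Rightarrow> complex) set" where
  "hermite_space n = complex_fun.span (hermite ` {0..n})"

text \<open>The vectors \<open>e i\<close> are not required to lie in \<open>V\<close>.\<close>

definition frame_with_bounds ::
    "(real \<Rightarrow> complex) set \<Rightarrow> 'i set \<Rightarrow> ('i \<Rightarrow> real \<Rightarrow> complex) \<Rightarrow> real \<Rightarrow> real \<Rightarrow> bool" where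
  "frame_with_bounds V I e A B \<longleftrightarrow> (\<forall>f\<in>V.
     (\<lambda>i. (cmod (L2_inner f (e i)))\<^sup>2) summable_on I \<and>
     A * (L2_norm f)\<^sup>2 \<le> (\<Sum>\<^sub>\<infinity>i\<in>I. (cmod (L2_inner f (e i)))\<^sup>2) \<and>
     (\<Sum>\<^sub>\<infinity>i\<in>I. (cmod (L2_inner f (e i)))\<^sup>2) \<le> B * (L2_norm f)\<^sup>2)"

end

theory Submission
  imports Defs "HOL-Probability.Probability" "HOL-Real_Asymp.Real_Asymp"
begin

text \<open>The Bargmann transform is an isometry that maps \<open>V\<^sub>n\<close> onto the polynomials of degree at most \<open>n\<close> and
  turns \<open>|\<langle>f, \<pi>(z) h\<^sub>0\<rangle>|\<^sup>2\<close> into \<open>|F(z)|\<^sup>2 exp (- \<pi> |z|\<^sup>2)\<close> (after conjugating the coefficients). The upper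
  frame bound is then the upper sampling inequality. For the lower one, the sum over the omitted points
  \<open>\<pi> |z|\<^sup>2 > n + \<surd>n \<tau>\<close> has to be small: apply the upper sampling inequality to \<open>z\<^sup>m F\<close> instead of \<open>F\<close>.
  Since \<open>\<parallel>z\<^sup>m F\<parallel>\<^sup>2 \<le> ((n + m) / \<pi>)\<^sup>m \<parallel>F\<parallel>\<^sup>2\<close>, the omitted part is at most
  \<open>B ((n + m) / (n + \<surd>n \<tau>))\<^sup>m \<parallel>F\<parallel>\<^sup>2\<close>, and for \<open>m\<close> the least integer above \<open>\<surd>n\<close> this is
  \<open>O(1 / \<tau>) \<parallel>F\<parallel>\<^sup>2\<close> uniformly in \<open>n\<close>.\<close>

section \<open>Gaussian integrals of polynomials\<close>

lemma power_le_fact_exp: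
  fixes x :: real
  assumes "x \<ge> 0"
  shows "x ^ m \<le> fact m * exp x"
proof -
  have "x ^ m /\<^sub>R fact m \<le> (\<Sum>n. x ^ n /\<^sub>R fact n)"
    using sum_le_suminf[OF summable_exp_generic[of x], of "{m}"] assms by auto
  thus ?thesis by (simp add: exp_def field_simps)
qed

text \<open>The power is absorbed into \<open>fact m * exp x\<close>; completing the square then
  pays for the linear exponent \<open>(1 + c) * x\<close> with half of the Gaussian decay and a
  constant.\<close>

lemma power_exp_le_gauss:
  fixes a c x :: real
  assumes "a > 0" "x \<ge> 0"
  shows "x ^ m * exp (c * x - a * x\<^sup>2) \<le> fact m * exp ((1 + c)\<^sup>2 / (2 * a)) * exp (- (a / 2) * x\<^sup>2)"
proof -
  have "0 \<le> (a * x - (1 + c))\<^sup>2 / (2 * a)" using assms by simp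
  also have "\<dots> = a / 2 * x\<^sup>2 - (1 + c) * x + (1 + c)\<^sup>2 / (2 * a)"
    using assms by (simp add: field_simps power2_eq_square)
  finally have *: "x + (c * x - a * x\<^sup>2) \<le> (1 + c)\<^sup>2 / (2 * a) + (- (a / 2) * x\<^sup>2)"
    by (simp add: algebra_simps)
  have "x ^ m * exp (c * x - a * x\<^sup>2) \<le> fact m * exp x * exp (c * x - a * x\<^sup>2)"
    using power_le_fact_exp[OF assms(2)] by (intro mult_right_mono) auto
  also have "\<dots> = fact m * exp (x + (c * x - a * x\<^sup>2))" by (simp add: exp_add mult.assoc)
  also have "\<dots> \<le> fact m * exp ((1 + c)\<^sup>2 / (2 * a) + (- (a / 2) * x\<^sup>2))"
    using * by (intro mult_left_mono) auto
  finally show ?thesis by (simp only: exp_add mult.assoc)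
qed

text \<open>The integrand is a multiple of the centred normal density with variance
  \<open>1 / (2 * a)\<close>.\<close>

lemma integrable_gauss:
  fixes a :: real
  assumes "a > 0"
  shows "integrable lborel (\<lambda>t. exp (- a * t\<^sup>2))" "(\<integral>t. exp (- a * t\<^sup>2) \<partial>lborel) = sqrt (pi / a)"
proof -
  define s where "s = sqrt (1 / (2 * a))"
  have s: "s > 0" "2 * s\<^sup>2 = 1 / a" using assms by (auto simp: s_def)
  have eq: "exp (- a * t\<^sup>2) = sqrt (pi / a) * normal_density 0 s t" for t
  proof -
    have "- (t - 0)\<^sup>2 / (2 * s\<^sup>2) = - a * t\<^sup>2" using assms by (simp add: s(2))
    moreover have "2 * pi * s\<^sup>2 = pi / a" using s(2) by (metis mult.commute mult.assoc times_divide_eq_right mult.right_neutral)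
    ultimately show ?thesis using assms unfolding normal_density_def by simp
  qed
  show "integrable lborel (\<lambda>t. exp (- a * t\<^sup>2))" unfolding eq using s by simp
  show "(\<integral>t. exp (- a * t\<^sup>2) \<partial>lborel) = sqrt (pi / a)" unfolding eq using s by simp
qed

text \<open>The linear exponent \<open>b\<close> is complex so that the same integrals serve Hermite
  orthogonality (\<open>b = 0\<close>) and the Gabor transform
  (\<open>b = 2 * pi * cnj z\<close>).\<close>

definition gexp :: "real \<Rightarrow> complex \<Rightarrow> real \<Rightarrow> complex" where
  "gexp a b t = exp (b * of_real t - of_real (a * t\<^sup>2))"

definition gint :: "real \<Rightarrow> complex \<Rightarrow> complex poly \<Rightarrow> complex" where
  "gint a b q = (\<integral>t. poly q (of_real t) * gexp a b t \<partial>lborel)"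

lemma norm_gexp: "norm (gexp a b t) = exp (Re b * t - a * t\<^sup>2)"
  by (simp add: gexp_def norm_exp_eq_Re flip: of_real_power)

lemma gexp_0: "gexp a 0 t = of_real (exp (- (a * t\<^sup>2)))"
proof -
  have "gexp a 0 t = exp (of_real (- (a * t\<^sup>2)))" by (simp add: gexp_def)
  thus ?thesis by (simp only: exp_of_real)
qed

text \<open>One Gaussian majorant, obtained coefficientwise from \<open>power_exp_le_gauss\<close>,
  yields both integrability and the vanishing of boundary terms.\<close>

lemma gexp_bound:
  assumes "a > 0"
  obtains C where "\<And>t. norm (poly q (of_real t) * gexp a b t) \<le> C * exp (- (a / 2) * t\<^sup>2)"
proof -
  define C where "C = (\<Sum>i\<le>degree q. norm (coeff q i) * (fact i * exp ((1 + \<bar>Re b\<bar>)\<^sup>2 / (2 * a))))"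
  show thesis
  proof (rule that[of C])
    fix t :: real
    have g: "norm (gexp a b t) \<le> exp (\<bar>Re b\<bar> * \<bar>t\<bar> - a * \<bar>t\<bar>\<^sup>2)"
      unfolding norm_gexp by (simp flip: abs_mult)
    have "norm (poly q (of_real t) * gexp a b t) \<le> (\<Sum>i\<le>degree q. norm (coeff q i) * \<bar>t\<bar> ^ i) * exp (\<bar>Re b\<bar> * \<bar>t\<bar> - a * \<bar>t\<bar>\<^sup>2)"
      unfolding norm_mult
    proof (intro mult_mono g)
      show "norm (poly q (of_real t)) \<le> (\<Sum>i\<le>degree q. norm (coeff q i) * \<bar>t\<bar> ^ i)"
        unfolding poly_altdef by (rule order.trans[OF norm_sum]) (simp add: norm_mult norm_power)
    qed (auto intro: sum_nonneg)
    also have "\<dots> = (\<Sum>i\<le>degree q. norm (coeff q i) * (\<bar>t\<bar> ^ i * exp (\<bar>Re b\<bar> * \<bar>t\<bar> - a * \<bar>t\<bar>\<^sup>2)))"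
      by (simp add: sum_distrib_right mult.assoc)
    also have "\<dots> \<le> (\<Sum>i\<le>degree q. norm (coeff q i) * (fact i * exp ((1 + \<bar>Re b\<bar>)\<^sup>2 / (2 * a)) * exp (- (a / 2) * \<bar>t\<bar>\<^sup>2)))"
      by (intro sum_mono mult_left_mono power_exp_le_gauss assms) auto
    also have "\<dots> = C * exp (- (a / 2) * t\<^sup>2)"
      by (simp add: C_def sum_distrib_right mult.assoc)
    finally show "norm (poly q (of_real t) * gexp a b t) \<le> C * exp (- (a / 2) * t\<^sup>2)" .
  qed
qed

lemma continuous_poly_gexp: "isCont (\<lambda>t. poly q (of_real t) * gexp a b t) t"
  unfolding gexp_def by (intro continuous_intros isCont_o2[OF _ poly_isCont] )

lemma measurable_poly_gexp [measurable]: "(\<lambda>t. poly q (of_real t) * gexp a b t) \<in> borel_measurable borel"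
  by (intro borel_measurable_continuous_onI continuous_at_imp_continuous_on ballI continuous_poly_gexp)

lemma integrable_poly_gexp:
  assumes "a > 0"
  shows "integrable lborel (\<lambda>t. poly q (of_real t) * gexp a b t)"
proof -
  obtain C where C: "\<And>t. norm (poly q (of_real t) * gexp a b t) \<le> C * exp (- (a / 2) * t\<^sup>2)"
    using gexp_bound[OF assms] by blast
  have "integrable lborel (\<lambda>t. C * exp (- (a / 2) * t\<^sup>2))"
    using integrable_gauss(1)[of "a / 2"] assms by simp
  thus ?thesis
    by (rule Bochner_Integration.integrable_bound) (use C in \<open>auto intro: order.trans[OF _ abs_ge_self]\<close>)
qed

lemma gexp_tendsto_0:
  assumes "a > 0"
  shows "((\<lambda>t. poly q (of_real t) * gexp a b t) \<longlongrightarrow> 0) at_top"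
    "((\<lambda>t. poly q (of_real t) * gexp a b t) \<longlongrightarrow> 0) at_bot"
proof -
  obtain C where C: "\<And>t. norm (poly q (of_real t) * gexp a b t) \<le> C * exp (- (a / 2) * t\<^sup>2)"
    using gexp_bound[OF assms] by blast
  have "((\<lambda>t. C * exp (- (a / 2) * t\<^sup>2)) \<longlongrightarrow> 0) at_top"
    using assms by real_asymp
  thus "((\<lambda>t. poly q (of_real t) * gexp a b t) \<longlongrightarrow> 0) at_top"
    by (rule Lim_null_comparison[OF always_eventually[OF allI[OF C]]])
  have "((\<lambda>t. C * exp (- (a / 2) * t\<^sup>2)) \<longlongrightarrow> 0) at_bot"
    using assms by real_asymp
  thus "((\<lambda>t. poly q (of_real t) * gexp a b t) \<longlongrightarrow> 0) at_bot"
    by (rule Lim_null_comparison[OF always_eventually[OF allI[OF C]]])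
qed

text \<open>The integrand is the derivative of \<open>poly q t * gexp a b t\<close>, which tends to
  0 at both ends. Integration by parts thereby becomes an identity between polynomials; Hermite
  orthogonality, the Gabor transform and the Fock moments all rest on it.\<close>

lemma gint_parts:
  assumes "a > 0"
  shows "gint a b (pderiv q + [:b, - 2 * of_real a:] * q) = 0"
proof -
  let ?f = "\<lambda>t. poly (pderiv q + [:b, - 2 * of_real a:] * q) (of_real t) * gexp a b t"
  let ?F = "\<lambda>t. poly q (of_real t) * gexp a b t"
  have "(LBINT t=-\<infinity>..\<infinity>. ?f t) = 0 - 0"
  proof (rule interval_integral_FTC_integrable)
    fix t :: real
    have "((\<lambda>z. poly q z * exp (b * z - of_real a * z\<^sup>2)) has_field_derivative ?f t) (at (of_real t))"
      unfolding gexp_def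
      by (auto intro!: derivative_eq_intros poly_DERIV simp: algebra_simps)
    from has_vector_derivative_real_field[OF this]
    show "(?F has_vector_derivative ?f t) (at t)" by (simp add: gexp_def)
    show "isCont ?f t" by (rule continuous_poly_gexp)
  next
    show "set_integrable lborel (einterval (-\<infinity>) \<infinity>) ?f"
      unfolding set_integrable_def using integrable_poly_gexp[OF assms] by (simp del: poly_add poly_mult poly_pCons)
    show "((?F \<circ> real_of_ereal) \<longlongrightarrow> 0) (at_right (-\<infinity>))"
      unfolding comp_def at_right_MInf filterlim_filtermap by (simp add: gexp_tendsto_0[OF assms])
    show "((?F \<circ> real_of_ereal) \<longlongrightarrow> 0) (at_left \<infinity>)"
      unfolding comp_def at_left_PInf filterlim_filtermap by (simp add: gexp_tendsto_0[OF assms])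
  qed simp
  thus ?thesis unfolding gint_def
    by (simp add: interval_lebesgue_integral_def set_lebesgue_integral_def)
qed

lemma gint_add: "a > 0 \<Longrightarrow> gint a b (p + q) = gint a b p + gint a b q"
  unfolding gint_def by (simp add: distrib_right integrable_poly_gexp Bochner_Integration.integral_add)

lemma gint_smult: "gint a b (smult c p) = c * gint a b p"
  unfolding gint_def by (simp add: mult.assoc)

lemma gint_const: "gint a b [:c:] = c * gint a b 1"
  using gint_smult[of a b c 1] by simp

text \<open>The substitution \<open>t = x + c * u\<close> centres the Gaussian at
  \<open>Re b / (2 * a)\<close> and normalizes its width, which removes \<open>Re b\<close>. The
  oscillation left by \<open>Im b\<close> is the characteristic function of the standard normal
  distribution.\<close>

lemma gint_one:
  assumes a: "a > 0"
  shows "gint a b 1 = of_real (sqrt (pi / a)) * exp (b\<^sup>2 / (4 * of_real a))"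
proof -
  define c where "c = 1 / sqrt (2 * a)"
  have c: "c > 0" "c * c = 1 / (2 * a)" using a by (auto simp: c_def)
  define x where "x = Re b / (2 * a)"
  define y where "y = Im b"
  have b: "b = 2 * of_real (a * x) + \<i> * of_real y"
    using a by (simp add: x_def y_def complex_eq_iff)
  let ?d = "\<lambda>u. std_normal_density u *\<^sub>R iexp (y * c * u)"
  have eq: "gexp a b (x + c * u) = exp (of_real (a * x\<^sup>2) + \<i> * of_real (x * y)) * of_real (sqrt (2 * pi)) * ?d u" for u
  proof -
    have "b * of_real (x + c * u) - of_real (a * (x + c * u)\<^sup>2) =
       of_real (a * x\<^sup>2) + \<i> * of_real (x * y) + (\<i> * of_real (y * c * u) + of_real (- (a * (c * c) * u\<^sup>2)))"
      unfolding b by (simp add: algebra_simps power2_eq_square)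
    also have "- (a * (c * c) * u\<^sup>2) = - u\<^sup>2 / 2" using a by (simp add: c(2))
    finally have "gexp a b (x + c * u) = exp (of_real (a * x\<^sup>2) + \<i> * of_real (x * y)) *
       (iexp (y * c * u) * of_real (exp (- u\<^sup>2 / 2)))"
      unfolding gexp_def by (simp only: exp_add exp_of_real)
    thus ?thesis by (simp add: std_normal_density_def scaleR_conv_of_real)
  qed
  have "(\<integral>u. ?d u \<partial>lborel) = char std_normal_distribution (y * c)"
    unfolding char_def by (subst integral_density) auto
  also have "\<dots> = of_real (exp (- (y * c)\<^sup>2 / 2))"
    by (simp add: char_std_normal_distribution)
  finally have *: "(\<integral>u. ?d u \<partial>lborel) = of_real (exp (- (y * c)\<^sup>2 / 2))" .
  have "gint a b 1 = (\<integral>t. gexp a b t \<partial>lborel)" by (simp add: gint_def)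
  also have "\<dots> = c *\<^sub>R (\<integral>u. gexp a b (x + c * u) \<partial>lborel)"
    using c by (subst lborel_integral_real_affine[where c = c and t = x]) auto
  also have "\<dots> = of_real (c * sqrt (2 * pi)) * exp (of_real (a * x\<^sup>2) + \<i> * of_real (x * y) + of_real (- (y * c)\<^sup>2 / 2))"
    unfolding eq integral_mult_right_zero * by (simp only: scaleR_conv_of_real exp_add exp_of_real of_real_mult mult_ac)
  also have "c * sqrt (2 * pi) = sqrt (pi / a)"
    using a by (simp add: c_def real_sqrt_mult real_sqrt_divide)
  also have "of_real (a * x\<^sup>2) + \<i> * of_real (x * y) + of_real (- (y * c)\<^sup>2 / 2) = b\<^sup>2 / (4 * of_real a)"
  proof -
    have yc: "(y * c)\<^sup>2 = y\<^sup>2 / (2 * a)"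
      unfolding power_mult_distrib power2_eq_square[of c] c(2) by simp
    show ?thesis using a unfolding b yc by (simp add: field_simps power2_eq_square)
  qed
  finally show ?thesis .
qed

section \<open>Hermite functions\<close>

text \<open>The recurrence is the product rule for differentiating
  \<open>poly p s * exp (- 2 * pi * s^2)\<close>. In terms of the physicists' Hermite polynomials
  \<open>H_k\<close>, this is \<open>(-1)^k (2 pi)^(k/2) H_k(sqrt (2 pi) s)\<close>.\<close>

fun hermite_poly :: "nat \<Rightarrow> real poly" where
  "hermite_poly 0 = 1"
| "hermite_poly (Suc k) = pderiv (hermite_poly k) + [:0, - 4 * pi:] * hermite_poly k"

lemma higher_deriv_gauss:
  "(deriv ^^ k) (\<lambda>s::real. exp (- 2 * pi * s\<^sup>2)) = (\<lambda>s. poly (hermite_poly k) s * exp (- 2 * pi * s\<^sup>2))"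
proof (induction k)
  case (Suc k)
  show ?case
  proof
    fix s :: real
    have "((\<lambda>s. poly (hermite_poly k) s * exp (- 2 * pi * s\<^sup>2)) has_field_derivative
      poly (hermite_poly (Suc k)) s * exp (- 2 * pi * s\<^sup>2)) (at s)"
      by (auto intro!: derivative_eq_intros poly_DERIV simp: algebra_simps)
    thus "(deriv ^^ Suc k) (\<lambda>s::real. exp (- 2 * pi * s\<^sup>2)) s = poly (hermite_poly (Suc k)) s * exp (- 2 * pi * s\<^sup>2)"
      by (simp only: funpow.simps o_apply Suc.IH DERIV_imp_deriv)
  qed
qed auto

definition cpoly :: "real poly \<Rightarrow> complex poly" where
  "cpoly = map_poly of_real"

lemma coeff_cpoly [simp]: "coeff (cpoly p) i = of_real (coeff p i)"
  by (simp add: cpoly_def coeff_map_poly)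

lemma cpoly_simps [simp]:
  "cpoly 0 = 0" "cpoly 1 = 1" "cpoly (p + q) = cpoly p + cpoly q" "cpoly (- p) = - cpoly p"
  "cpoly (smult c p) = smult (of_real c) (cpoly p)"
  "cpoly (pCons c p) = pCons (of_real c) (cpoly p)" "cpoly (pderiv p) = pderiv (cpoly p)"
  by (auto simp: poly_eq_iff coeff_pderiv coeff_pCons split: nat.split)

lemma poly_cpoly [simp]: "poly (cpoly p) (of_real t) = of_real (poly p t)"
  by (induction p) auto

lemma hermite_unnormalized_eq:
  "hermite_unnormalized k t = of_real (poly (hermite_poly k) t * exp (- pi * t\<^sup>2))"
  unfolding hermite_unnormalized_def higher_deriv_gauss
  by (simp add: mult.left_commute flip: exp_add)

text \<open>\<open>gint_parts\<close> for \<open>q * hermite_poly k\<close>: one derivative moves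
  from the Hermite factor onto \<open>q\<close> times the exponential with exponent
  \<open>b * t\<close>. Iterating it with \<open>b = 0\<close> leads to orthogonality, and with
  \<open>q = 1\<close> to powers of \<open>- b\<close>.\<close>

lemma gint_hermite_Suc:
  "gint (2 * pi) b (q * cpoly (hermite_poly (Suc k))) =
     - gint (2 * pi) b ((pderiv q + smult b q) * cpoly (hermite_poly k))"
proof -
  let ?h = "cpoly (hermite_poly k)"
  have "q * cpoly (hermite_poly (Suc k)) + (pderiv q + smult b q) * ?h =
    pderiv (q * ?h) + [:b, - 2 * of_real (2 * pi):] * (q * ?h)"
    by (simp add: pderiv_mult algebra_simps)
  hence "gint (2 * pi) b (q * cpoly (hermite_poly (Suc k)) + (pderiv q + smult b q) * ?h) = 0"
    using gint_parts[of "2 * pi" b "q * ?h"] by (simp only:) simp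
  thus ?thesis
    by (subst (asm) gint_add) (simp_all only: eq_neg_iff_add_eq_0, simp)
qed

lemma gint_hermite_0:
  "gint (2 * pi) 0 (q * cpoly (hermite_poly k)) = (- 1) ^ k * gint (2 * pi) 0 ((pderiv ^^ k) q)"
proof (induction k arbitrary: q)
  case (Suc k)
  thus ?case
    by (simp only: gint_hermite_Suc Suc.IH funpow_Suc_right o_def) simp
qed simp

lemma gint_hermite:
  "gint (2 * pi) b (cpoly (hermite_poly k)) = (- b) ^ k * gint (2 * pi) b 1"
proof (induction k)
  case (Suc k)
  show ?case
    using gint_hermite_Suc[of b 1 k] Suc.IH by (simp add: gint_smult pderiv_1 del: hermite_poly.simps(2))
qed simp

lemma degree_hermite_poly: "degree (hermite_poly k) \<le> k"
proof (induction k)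
  case (Suc k)
  have "degree ([:0, - 4 * pi:] * hermite_poly k) \<le> Suc k"
    using degree_mult_le[of "[:0, - 4 * pi:]" "hermite_poly k"] Suc.IH by simp
  moreover have "degree (pderiv (hermite_poly k)) \<le> Suc k"
    using Suc.IH by (simp add: degree_pderiv)
  ultimately show ?case by (simp only: hermite_poly.simps degree_add_le)
qed simp

lemma coeff_hermite_poly: "coeff (hermite_poly k) k = (- 4 * pi) ^ k"
proof (induction k)
  case (Suc k)
  have "coeff (pderiv (hermite_poly k)) (Suc k) = 0"
    using degree_hermite_poly[of k] by (simp add: coeff_pderiv coeff_eq_0)
  thus ?case using Suc.IH by simp
qed simp

lemma higher_pderiv_eq:
  assumes "degree p \<le> k"
  shows "(pderiv ^^ k) (p::complex poly) = [:fact k * coeff p k:]"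
  using assms
proof (induction k arbitrary: p)
  case 0 thus ?case by (auto elim: degree_eq_zeroE)
next
  case (Suc k)
  have "(pderiv ^^ k) (pderiv p) = [:fact k * coeff (pderiv p) k:]"
    using Suc.prems by (intro Suc.IH) (simp add: degree_pderiv)
  thus ?case by (simp add: funpow_Suc_right coeff_pderiv del: funpow.simps) 
qed

text \<open>For \<open>j \<le> k\<close>, all \<open>k\<close> derivatives fall on a polynomial of
  degree at most \<open>j\<close>. What remains is \<open>fact k\<close> times its coefficient at
  \<open>k\<close>, which is 0 for \<open>j < k\<close> and \<open>(- 4 * pi) ^ k\<close> for
  \<open>j = k\<close>.\<close>

lemma gint_hermite_orthogonal:
  "gint (2 * pi) 0 (cpoly (hermite_poly j) * cpoly (hermite_poly k)) =
     (if j = k then of_real (fact k * (4 * pi) ^ k / sqrt 2) else 0)"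
proof -
  have wlog: "gint (2 * pi) 0 (cpoly (hermite_poly j) * cpoly (hermite_poly k)) =
     (if j = k then of_real (fact k * (4 * pi) ^ k / sqrt 2) else 0)" if "j \<le> k" for j k
  proof -
    have c: "coeff (cpoly (hermite_poly j)) i = of_real (coeff (hermite_poly j) i)" for i
      by (simp add: cpoly_def coeff_map_poly)
    have d: "degree (cpoly (hermite_poly j)) = degree (hermite_poly j)"
      by (simp add: cpoly_def degree_map_poly)
    have "gint (2 * pi) 0 (cpoly (hermite_poly j) * cpoly (hermite_poly k)) =
      (- 1) ^ k * (fact k * of_real (coeff (hermite_poly j) k) * gint (2 * pi) 0 1)"
      unfolding gint_hermite_0
      using higher_pderiv_eq[of "cpoly (hermite_poly j)" k] degree_hermite_poly[of j] that
      by (simp add: c d gint_const)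
    moreover have "coeff (hermite_poly j) k = 0" if "j < k"
      using that degree_hermite_poly[of j] by (intro coeff_eq_0) auto
    moreover have "(- 1) ^ k * (- 4 * pi) ^ k = (4 * pi) ^ k"
      using power_mult_distrib[of "- 1" "- 4 * pi" k] by simp
    hence "(- 1) ^ k * (of_real ((- 4 * pi) ^ k) :: complex) = of_real ((4 * pi) ^ k)"
      by (metis of_real_1 of_real_minus of_real_mult of_real_power)
    moreover have "gint (2 * pi) 0 1 = of_real (1 / sqrt 2)"
      using gint_one[of "2 * pi" 0] by (simp add: real_sqrt_divide)
    ultimately show ?thesis using that coeff_hermite_poly[of k]
      by (cases "j = k") (simp_all add: mult_ac)
  qed
  show ?thesis
  proof (cases "j \<le> k")
    case False
    thus ?thesis using wlog[of k j] by (simp add: mult.commute)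
  qed (use wlog in blast)
qed

text \<open>The diagonal value in \<open>gint_hermite_orthogonal\<close>, hence the squared norm of
  \<open>hermite_unnormalized k\<close>.\<close>

definition hermite_sqnorm :: "nat \<Rightarrow> real" where
  "hermite_sqnorm k = fact k * (4 * pi) ^ k / sqrt 2"

lemma hermite_sqnorm_pos: "hermite_sqnorm k > 0"
  by (simp add: hermite_sqnorm_def)

lemma hermite_unnormalized_mult:
  "hermite_unnormalized j t * cnj (hermite_unnormalized k t) =
     poly (cpoly (hermite_poly j) * cpoly (hermite_poly k)) (of_real t) * gexp (2 * pi) 0 t"
proof -
  have "exp (- pi * t\<^sup>2) * exp (- pi * t\<^sup>2) = exp (- (2 * pi * t\<^sup>2))"
    by (simp flip: exp_add)
  hence "complex_of_real (exp (- pi * t\<^sup>2)) * of_real (exp (- pi * t\<^sup>2)) = gexp (2 * pi) 0 t"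
    by (simp only: gexp_0 flip: of_real_mult)
  thus ?thesis by (simp add: hermite_unnormalized_eq)
qed

lemma L2_norm_hermite_unnormalized: "L2_norm (hermite_unnormalized k) = sqrt (hermite_sqnorm k)"
proof -
  have "complex_of_real (\<integral>t. (cmod (hermite_unnormalized k t))\<^sup>2 \<partial>lborel) =
    gint (2 * pi) 0 (cpoly (hermite_poly k) * cpoly (hermite_poly k))"
    unfolding integral_complex_of_real[symmetric] complex_norm_square hermite_unnormalized_mult gint_def ..
  thus ?thesis
    unfolding gint_hermite_orthogonal L2_norm_def hermite_sqnorm_def by (simp only: if_True of_real_eq_iff refl)
qed

lemma hermite_eq: "hermite k t = of_real (1 / sqrt (hermite_sqnorm k)) * hermite_unnormalized k t"
  by (simp add: hermite_def L2_norm_hermite_unnormalized)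

lemma
  shows integrable_hermite: "integrable lborel (\<lambda>t. hermite j t * cnj (hermite k t))"
    and hermite_orthonormal: "(\<integral>t. hermite j t * cnj (hermite k t) \<partial>lborel) = (if j = k then 1 else 0)"
proof -
  have eq: "hermite j t * cnj (hermite k t) = of_real (1 / sqrt (hermite_sqnorm j) * (1 / sqrt (hermite_sqnorm k))) *
     (poly (cpoly (hermite_poly j) * cpoly (hermite_poly k)) (of_real t) * gexp (2 * pi) 0 t)" for t
    unfolding hermite_eq hermite_unnormalized_mult[symmetric] by simp
  show "integrable lborel (\<lambda>t. hermite j t * cnj (hermite k t))"
    unfolding eq by (intro integrable_mult_right integrable_poly_gexp) simp
  show "(\<integral>t. hermite j t * cnj (hermite k t) \<partial>lborel) = (if j = k then 1 else 0)"
    unfolding eq integral_mult_right_zero gint_def[symmetric] gint_hermite_orthogonal hermite_sqnorm_def[symmetric]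
    using hermite_sqnorm_pos[of k] by (simp flip: of_real_mult)
qed

text \<open>Span induction: adding a multiple of one Hermite function changes a single
  coefficient.\<close>

lemma hermite_space_obtain:
  assumes "f \<in> hermite_space n"
  obtains a where "f = (\<lambda>t. \<Sum>k\<le>n. a k * hermite k t)"
proof -
  have "\<exists>a. f = (\<lambda>t. \<Sum>k\<le>n. a k * hermite k t)"
    using assms unfolding hermite_space_def
  proof (induction rule: complex_fun.span_induct_alt)
    case base
    show ?case by (intro exI[of _ "\<lambda>_. 0"]) (simp add: fun_eq_iff)
  next
    case (step c x y)
    then obtain a m where a: "y = (\<lambda>t. \<Sum>k\<le>n. a k * hermite k t)" and m: "m \<le> n" "x = hermite m" by auto
    have "(\<Sum>k\<le>n. (if k = m then c else 0) * hermite k t) = c * hermite m t" for t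
      using m(1) by (simp add: if_distrib[of "\<lambda>u. u * _"] cong: if_cong)
    hence "(\<lambda>t. c * x t) + y = (\<lambda>t. \<Sum>k\<le>n. ((if k = m then c else 0) + a k) * hermite k t)"
      unfolding a m(2) by (simp only: fun_eq_iff plus_fun_apply distrib_right sum.distrib) simp
    thus ?case by (rule exI[of _ "\<lambda>k. (if k = m then c else 0) + a k"])
  qed
  thus thesis using that by blast
qed

lemma L2_norm_hermite_sum:
  "(L2_norm (\<lambda>t. \<Sum>k\<le>n. a k * hermite k t))\<^sup>2 = (\<Sum>k\<le>n. (cmod (a k))\<^sup>2)"
proof -
  let ?f = "\<lambda>t. \<Sum>k\<le>n. a k * hermite k t"
  have eq: "complex_of_real ((cmod (?f t))\<^sup>2) = (\<Sum>j\<le>n. \<Sum>k\<le>n. a j * cnj (a k) * (hermite j t * cnj (hermite k t)))" for t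
    unfolding complex_norm_square cnj_sum sum_product
    by (intro sum.cong refl) (simp add: mult_ac)
  have "complex_of_real (\<integral>t. (cmod (?f t))\<^sup>2 \<partial>lborel) =
      (\<Sum>j\<le>n. \<Sum>k\<le>n. a j * cnj (a k) * (\<integral>t. hermite j t * cnj (hermite k t) \<partial>lborel))"
    unfolding integral_complex_of_real[symmetric] eq by (simp add: integrable_hermite)
  also have "\<dots> = of_real (\<Sum>k\<le>n. (cmod (a k))\<^sup>2)"
    by (simp add: hermite_orthonormal complex_norm_square[symmetric] if_distrib cong: if_cong)
  finally have "(\<integral>t. (cmod (?f t))\<^sup>2 \<partial>lborel) = (\<Sum>k\<le>n. (cmod (a k))\<^sup>2)"
    by (simp only: of_real_eq_iff)
  thus ?thesis unfolding L2_norm_def by (simp add: sum_nonneg)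
qed

section \<open>Gabor transform of Hermite functions with Gaussian window\<close>

definition gabor_factor :: "complex \<Rightarrow> complex" where
  "gabor_factor z = of_real (exp (- pi * (Re z)\<^sup>2)) * gint (2 * pi) (2 * of_real pi * cnj z) 1 / of_real (sqrt (hermite_sqnorm 0))"

text \<open>With \<open>z = x + i y\<close>, the Gaussian integral has modulus proportional to
  \<open>exp (pi / 2 * (x^2 - y^2))\<close>; the prefactor \<open>exp (- pi * x^2)\<close> makes the
  exponent rotation invariant, and squaring gives the Fock weight.\<close>

lemma norm_gabor_factor: "(cmod (gabor_factor z))\<^sup>2 = exp (- pi * (cmod z)\<^sup>2) / sqrt 2"
proof -
  have 1: "(2 * of_real pi * cnj z)\<^sup>2 / (4 * of_real (2 * pi)) = of_real (pi / 2) * (cnj z)\<^sup>2"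
    by (simp add: field_simps power2_eq_square)
  have 2: "Re (of_real (pi / 2) * (cnj z)\<^sup>2) = pi / 2 * ((Re z)\<^sup>2 - (Im z)\<^sup>2)"
    by (simp add: power2_eq_square)
  have "cmod (gint (2 * pi) (2 * of_real pi * cnj z) 1) = sqrt (1 / 2) * exp (pi / 2 * ((Re z)\<^sup>2 - (Im z)\<^sup>2))"
    by (subst gint_one) (simp_all only: 1 2 norm_mult norm_exp_eq_Re norm_of_real, simp_all)
  hence "(cmod (gabor_factor z))\<^sup>2 = (exp (- pi * (Re z)\<^sup>2) * exp (pi / 2 * ((Re z)\<^sup>2 - (Im z)\<^sup>2)))\<^sup>2 / 2 / hermite_sqnorm 0"
    using hermite_sqnorm_pos[of 0]
    by (simp add: gabor_factor_def norm_mult norm_divide power_mult_distrib power_divide)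
  also have "(exp (- pi * (Re z)\<^sup>2) * exp (pi / 2 * ((Re z)\<^sup>2 - (Im z)\<^sup>2)))\<^sup>2 = exp (- pi * (cmod z)\<^sup>2)"
  proof -
    have "2 * (- pi * R + pi / 2 * (R - I)) = - pi * (R + I)" for R I :: real
      by (simp add: field_simps)
    thus ?thesis by (simp only: cmod_power2 flip: exp_add exp_double)
  qed
  also have "e / 2 / hermite_sqnorm 0 = e / sqrt 2" for e
    by (simp add: hermite_sqnorm_def field_simps)
  finally show ?thesis .
qed

text \<open>The exponents of both Gaussians and of the modulation combine to
  \<open>- pi * (Re z)^2\<close> plus the exponent of \<open>gexp\<close> with
  \<open>b = 2 * pi * cnj z\<close>. By \<open>gint_hermite\<close>, the index \<open>k\<close> then
  enters only through a multiple of \<open>cnj z ^ k\<close>.\<close>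

lemma
  shows integrable_hermite_gabor: "integrable lborel (\<lambda>t. hermite k t * cnj (tf_shift z (hermite 0) t))"
    and hermite_gabor: "(\<integral>t. hermite k t * cnj (tf_shift z (hermite 0) t) \<partial>lborel) =
      gabor_factor z * (of_real ((- 2 * pi) ^ k / sqrt (hermite_sqnorm k)) * cnj z ^ k)"
proof -
  let ?b = "2 * of_real pi * cnj z"
  let ?C = "of_real (exp (- pi * (Re z)\<^sup>2) / (sqrt (hermite_sqnorm k) * sqrt (hermite_sqnorm 0))) :: complex"
  have eq: "hermite k t * cnj (tf_shift z (hermite 0) t) =
    ?C * (poly (cpoly (hermite_poly k)) (of_real t) * gexp (2 * pi) ?b t)" for t
  proof -
    have "of_real (- pi * t\<^sup>2) + (cnj (2 * of_real pi * \<i> * of_real (Im z) * of_real t) + of_real (- pi * (t - Re z)\<^sup>2)) =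
      of_real (- pi * (Re z)\<^sup>2) + (?b * of_real t - of_real (2 * pi * t\<^sup>2))"
      by (simp add: complex_eq_iff power2_eq_square algebra_simps)
    from arg_cong[OF this, of exp]
    have "of_real (exp (- pi * t\<^sup>2)) * (cnj (exp (2 * of_real pi * \<i> * of_real (Im z) * of_real t)) * of_real (exp (- pi * (t - Re z)\<^sup>2))) =
      of_real (exp (- pi * (Re z)\<^sup>2)) * gexp (2 * pi) ?b t"
      by (simp only: exp_add exp_of_real exp_cnj gexp_def)
    thus ?thesis
      unfolding hermite_eq tf_shift_def hermite_unnormalized_eq
      by (simp add: mult_ac)
  qed
  show "integrable lborel (\<lambda>t. hermite k t * cnj (tf_shift z (hermite 0) t))"
    unfolding eq by (intro integrable_mult_right integrable_poly_gexp) simp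
  have "- ?b = of_real (- 2 * pi) * cnj z" by simp
  hence "(- ?b) ^ k = of_real ((- 2 * pi) ^ k) * cnj z ^ k"
    by (metis power_mult_distrib of_real_power)
  thus "(\<integral>t. hermite k t * cnj (tf_shift z (hermite 0) t) \<partial>lborel) =
      gabor_factor z * (of_real ((- 2 * pi) ^ k / sqrt (hermite_sqnorm k)) * cnj z ^ k)"
    unfolding eq integral_mult_right_zero gint_def[symmetric] gint_hermite gabor_factor_def
    by (simp add: mult_ac)
qed

text \<open>Up to a unimodular factor and the Gaussian weight, the Gabor transform with Gaussian window is the Bargmann transform at \<open>z\<^sup>*\<close>;
  conjugating the coefficients moves the evaluation point back to \<open>z\<close>.\<close>

lemma hermite_sum_gabor:
  fixes a :: "nat \<Rightarrow> complex" and n :: nat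
  defines "c \<equiv> \<lambda>k. cnj (a k) * of_real ((- 2 * pi) ^ k / sqrt (sqrt 2 * hermite_sqnorm k))"
  shows "(cmod (L2_inner (\<lambda>t. \<Sum>k\<le>n. a k * hermite k t) (tf_shift z (hermite 0))))\<^sup>2 =
     (cmod (\<Sum>k\<le>n. c k * z ^ k))\<^sup>2 * exp (- pi * (cmod z)\<^sup>2)"
    and "(cmod (c k))\<^sup>2 * (fact k / pi ^ k) = (cmod (a k))\<^sup>2"
proof -
  have "L2_inner (\<lambda>t. \<Sum>k\<le>n. a k * hermite k t) (tf_shift z (hermite 0)) =
    (\<Sum>k\<le>n. a k * (\<integral>t. hermite k t * cnj (tf_shift z (hermite 0) t) \<partial>lborel))"
    unfolding L2_inner_def
    by (simp add: sum_distrib_right mult.assoc integrable_hermite_gabor)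
  also have "\<dots> = gabor_factor z * (\<Sum>k\<le>n. a k * (of_real ((- 2 * pi) ^ k / sqrt (hermite_sqnorm k)) * cnj z ^ k))"
    unfolding hermite_gabor sum_distrib_left by (simp add: mult_ac)
  \<comment> \<open>The constant taken out cancels the \<open>1 / sqrt 2\<close> of
    \<open>norm_gabor_factor\<close> after squaring.\<close>
  also have "(\<Sum>k\<le>n. a k * (of_real ((- 2 * pi) ^ k / sqrt (hermite_sqnorm k)) * cnj z ^ k)) =
     of_real (sqrt (sqrt 2)) * cnj (\<Sum>k\<le>n. c k * z ^ k)"
    unfolding sum_distrib_left cnj_sum
    by (intro sum.cong refl) (simp add: c_def real_sqrt_mult)
  finally show "(cmod (L2_inner (\<lambda>t. \<Sum>k\<le>n. a k * hermite k t) (tf_shift z (hermite 0))))\<^sup>2 =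
     (cmod (\<Sum>k\<le>n. c k * z ^ k))\<^sup>2 * exp (- pi * (cmod z)\<^sup>2)"
    by (simp only: norm_mult power_mult_distrib norm_gabor_factor complex_mod_cnj norm_of_real) simp
  \<comment> \<open>Since \<open>sqrt 2 * hermite_sqnorm k = fact k * (4 * pi) ^ k\<close>, the
    square of the real factor in \<open>c k\<close> is \<open>pi ^ k / fact k\<close>, the
    reciprocal of the squared Fock norm of \<open>z ^ k\<close>.\<close>
  have "(2 * pi) ^ k * (2 * pi) ^ k = (4 * pi) ^ k * pi ^ k"
    unfolding power_mult_distrib[symmetric] by (simp add: mult_ac)
  thus "(cmod (c k))\<^sup>2 * (fact k / pi ^ k) = (cmod (a k))\<^sup>2"
    using hermite_sqnorm_pos[of k]
    by (simp add: c_def norm_mult norm_divide norm_power power_mult_distrib power_divide hermite_sqnorm_def field_simps power2_eq_square)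
qed

section \<open>Polynomials in Fock space\<close>

lemma measurable_Complex [measurable]:
  "(\<lambda>p. Complex (fst p) (snd p)) \<in> borel_measurable (lborel \<Otimes>\<^sub>M lborel)"
proof -
  have "(\<lambda>p. of_real (fst p) + \<i> * of_real (snd p)) \<in> borel_measurable (lborel \<Otimes>\<^sub>M (lborel :: real measure))"
    by measurable
  thus ?thesis by (simp add: complex_eq_iff Complex_eq)
qed

lemma lborel_complex:
  "(lborel :: complex measure) = distr (lborel \<Otimes>\<^sub>M lborel) borel (\<lambda>p. Complex (fst p) (snd p))"
proof (rule lborel_eqI)
  fix l u :: complex
  assume le: "\<And>b. b \<in> Basis \<Longrightarrow> l \<bullet> b \<le> u \<bullet> b"
  have "Re l \<le> Re u" "Im l \<le> Im u"
    using le[of 1] le[of \<i>] by (auto simp: Basis_complex_def)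
  have "(\<lambda>p. Complex (fst p) (snd p)) -` box l u \<inter> space (lborel \<Otimes>\<^sub>M lborel) = {Re l<..<Re u} \<times> {Im l<..<Im u}"
    by (auto simp: box_def Basis_complex_def space_pair_measure)
  hence "emeasure (distr (lborel \<Otimes>\<^sub>M lborel) borel (\<lambda>p. Complex (fst p) (snd p))) (box l u) =
    emeasure (lborel \<Otimes>\<^sub>M lborel) ({Re l<..<Re u} \<times> {Im l<..<Im u})"
    by (subst emeasure_distr) auto
  also have "\<dots> = ennreal (Re u - Re l) * ennreal (Im u - Im l)"
    using \<open>Re l \<le> Re u\<close> \<open>Im l \<le> Im u\<close> by (subst lborel.emeasure_pair_measure_Times) auto
  also have "\<dots> = ennreal (\<Prod>b\<in>Basis. (u - l) \<bullet> b)"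
    using \<open>Re l \<le> Re u\<close> \<open>Im l \<le> Im u\<close> by (simp add: Basis_complex_def ennreal_mult)
  finally show "emeasure (distr (lborel \<Otimes>\<^sub>M lborel) borel (\<lambda>p. Complex (fst p) (snd p))) (box l u) = 
    ennreal (\<Prod>b\<in>Basis. (u - l) \<bullet> b)" .
qed simp

lemma
  fixes F :: "complex \<Rightarrow> 'b::{banach, second_countable_topology}"
  assumes [measurable]: "F \<in> borel_measurable borel"
  shows integrable_lborel_complex_iff:
      "integrable lborel F \<longleftrightarrow> integrable (lborel \<Otimes>\<^sub>M lborel) (\<lambda>(x, y). F (Complex x y))"
    and integral_lborel_complex:
      "(\<integral>z. F z \<partial>lborel) = (\<integral>(x, y). F (Complex x y) \<partial>(lborel \<Otimes>\<^sub>M lborel))"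
  by (simp_all add: lborel_complex integrable_distr_eq integral_distr case_prod_unfold)

text \<open>Both orders matter: each partial derivative is later integrated first in its own
  variable.\<close>

lemma integral_lborel_complex_iterated:
  fixes F :: "complex \<Rightarrow> complex"
  assumes F: "integrable lborel F"
  shows "(\<integral>z. F z \<partial>lborel) = (\<integral>x. (\<integral>y. F (Complex x y) \<partial>lborel) \<partial>lborel)"
    "(\<integral>z. F z \<partial>lborel) = (\<integral>y. (\<integral>x. F (Complex x y) \<partial>lborel) \<partial>lborel)"
proof -
  have [measurable]: "F \<in> borel_measurable borel"
    using borel_measurable_integrable[OF F] by simp
  have *: "integrable (lborel \<Otimes>\<^sub>M lborel) (\<lambda>(x, y). F (Complex x y))"
    using F by (simp add: integrable_lborel_complex_iff)
  show "(\<integral>z. F z \<partial>lborel) = (\<integral>x. (\<integral>y. F (Complex x y) \<partial>lborel) \<partial>lborel)"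
    "(\<integral>z. F z \<partial>lborel) = (\<integral>y. (\<integral>x. F (Complex x y) \<partial>lborel) \<partial>lborel)"
    using lborel_pair.integral_fst[OF *] lborel_pair.integral_snd[OF *]
    by (simp_all add: integral_lborel_complex)
qed

lemma integrable_gauss_complex:
  fixes a :: real
  assumes a: "a > 0"
  shows "integrable lborel (\<lambda>z::complex. exp (- a * (cmod z)\<^sup>2))"
proof -
  have "integrable (lborel \<Otimes>\<^sub>M lborel) (\<lambda>(x, y). exp (- a * x\<^sup>2) * exp (- a * y\<^sup>2))"
    by (rule lborel_pair.Fubini_integrable) (use integrable_gauss[OF a] in \<open>auto simp: abs_mult\<close>)
  also have "(\<lambda>(x, y). exp (- a * x\<^sup>2) * exp (- a * y\<^sup>2)) = (\<lambda>(x, y). exp (- a * (cmod (Complex x y))\<^sup>2))"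
    by (simp add: cmod_power2 algebra_simps flip: exp_add)
  finally show ?thesis
    by (subst integrable_lborel_complex_iff) auto
qed

section \<open>Inner products of monomials in Fock space\<close>

definition fock_monom :: "nat \<Rightarrow> nat \<Rightarrow> complex \<Rightarrow> complex" where
  "fock_monom j k z = z ^ j * cnj z ^ k * of_real (exp (- pi * (cmod z)\<^sup>2))"

lemma measurable_fock_monom [measurable]: "fock_monom j k \<in> borel_measurable borel"
  unfolding fock_monom_def by (intro borel_measurable_continuous_onI continuous_intros)

lemma integrable_fock_monom [simp]: "integrable lborel (fock_monom j k)"
proof -
  define C :: real where "C = fact (j + k) * exp ((1 + 0)\<^sup>2 / (2 * pi))"
  have "integrable lborel (\<lambda>z::complex. C * exp (- (pi / 2) * (cmod z)\<^sup>2))"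
    using integrable_gauss_complex[of "pi / 2"] by simp
  thus ?thesis
  proof (rule Bochner_Integration.integrable_bound)
    have "norm (fock_monom j k z) \<le> norm (C * exp (- (pi / 2) * (cmod z)\<^sup>2))" for z
    proof -
      have "norm (fock_monom j k z) = cmod z ^ (j + k) * exp (0 * cmod z - pi * (cmod z)\<^sup>2)"
        by (simp add: fock_monom_def norm_mult norm_power power_add)
      also have "\<dots> \<le> C * exp (- (pi / 2) * (cmod z)\<^sup>2)"
        unfolding C_def by (rule power_exp_le_gauss) auto
      finally show ?thesis by simp
    qed
    thus "AE z in lborel. norm (fock_monom j k z) \<le> norm (C * exp (- (pi / 2) * (cmod z)\<^sup>2))" by simp
  qed simp
qed

abbreviation fock_moment :: "nat \<Rightarrow> nat \<Rightarrow> complex" where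
  "fock_moment j k \<equiv> \<integral>z. fock_monom j k z \<partial>lborel"

lemma fock_moment_0_0: "fock_moment 0 0 = 1"
proof -
  have eq: "fock_monom 0 0 (Complex x y) = of_real (exp (- pi * x\<^sup>2) * exp (- pi * y\<^sup>2))" for x y
    by (simp add: fock_monom_def cmod_power2 algebra_simps flip: exp_add)
  show ?thesis
    using integrable_gauss(2)[of pi]
    by (simp only: integral_lborel_complex_iterated(1)[OF integrable_fock_monom] eq integral_complex_of_real) simp
qed

text \<open>Integrating \<open>\<partial>/\<partial>z\<^sup>*\<close> of \<open>z\<^sup>j (z\<^sup>*)\<^sup>k exp (- \<pi> z z\<^sup>*)\<close> over the plane gives zero.\<close>

lemma fock_moment_Suc: "fock_moment (Suc j) k = of_nat k / of_real pi * fock_moment j (k - 1)"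
proof -
  \<comment> \<open>\<open>f\<close> and \<open>g\<close> are the derivatives of
    \<open>fock_monom j k\<close> in \<open>x\<close> and \<open>y\<close>, with
    \<open>2 * x\<close> and \<open>2 * y\<close> rewritten through \<open>z\<close> and
    \<open>cnj z\<close>. Truncated subtraction at exponent 0 is harmless, as the coefficient is
    then 0.\<close>
  define f where "f = (\<lambda>z. of_nat j * fock_monom (j - 1) k z + of_nat k * fock_monom j (k - 1) z
    - of_real pi * (fock_monom (Suc j) k z + fock_monom j (Suc k) z))"
  define g where "g = (\<lambda>z. \<i> * (of_nat j * fock_monom (j - 1) k z - of_nat k * fock_monom j (k - 1) z
    + of_real pi * (fock_monom (Suc j) k z - fock_monom j (Suc k) z)))"
  have int: "integrable lborel f" "integrable lborel g"
    by (simp_all add: f_def g_def)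
  have W: "complex_of_real (exp (- pi * (cmod (Complex x y))\<^sup>2)) =
      gexp pi 0 x * of_real (exp (- pi * y\<^sup>2))"
    "complex_of_real (exp (- pi * (cmod (Complex x y))\<^sup>2)) =
      gexp pi 0 y * of_real (exp (- pi * x\<^sup>2))" for x y
    by (simp_all add: gexp_0 cmod_power2 algebra_simps flip: exp_add of_real_mult)
  have fx: "(\<integral>x. f (Complex x y) \<partial>lborel) = 0" for y
  proof -
    \<comment> \<open>On a horizontal line, \<open>z ^ j * cnj z ^ k\<close> is this polynomial in
      \<open>x\<close>, so \<open>gint_parts\<close> applies; vertical lines are treated
      alike.\<close>
    define q where "q = [:\<i> * of_real y, 1:] ^ j * [:- \<i> * of_real y, 1:] ^ k"
    have "f (Complex x y) = poly (pderiv q + [:0, - 2 * of_real pi:] * q) (of_real x) * gexp pi 0 x * of_real (exp (- pi * y\<^sup>2))" for x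
      unfolding f_def fock_monom_def W(1) q_def
      by (simp add: pderiv_mult pderiv_power pderiv_pCons Complex_eq algebra_simps)
    thus ?thesis using gint_parts[of pi 0 q] by (simp add: gint_def del: poly_add poly_mult)
  qed
  have gy: "(\<integral>y. g (Complex x y) \<partial>lborel) = 0" for x
  proof -
    define q where "q = [:of_real x, \<i>:] ^ j * [:of_real x, - \<i>:] ^ k"
    have "g (Complex x y) = poly (pderiv q + [:0, - 2 * of_real pi:] * q) (of_real y) * gexp pi 0 y * of_real (exp (- pi * x\<^sup>2))" for y
      unfolding g_def fock_monom_def W(2) q_def
      by (simp add: pderiv_mult pderiv_power pderiv_pCons Complex_eq algebra_simps)
    thus ?thesis using gint_parts[of pi 0 q] by (simp add: gint_def del: poly_add poly_mult)
  qed
  have "(\<integral>z. f z + \<i> * g z \<partial>lborel) = (\<integral>z. f z \<partial>lborel) + \<i> * (\<integral>z. g z \<partial>lborel)"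
    using int by simp
  also have "(\<integral>z. f z \<partial>lborel) = 0"
    using fx by (simp add: integral_lborel_complex_iterated(2)[OF int(1)])
  also have "(\<integral>z. g z \<partial>lborel) = 0"
    using gy by (simp add: integral_lborel_complex_iterated(1)[OF int(2)])
  \<comment> \<open>This combination is twice the derivative in \<open>cnj z\<close>, in which the
    terms with \<open>j\<close> and with \<open>Suc k\<close> cancel.\<close>
  also have "(\<lambda>z. f z + \<i> * g z) = (\<lambda>z. 2 * (of_nat k * fock_monom j (k - 1) z) - 2 * (of_real pi * fock_monom (Suc j) k z))"
    by (simp add: f_def g_def fun_eq_iff algebra_simps)
  finally have "2 * (of_nat k * fock_moment j (k - 1)) - 2 * (of_real pi * fock_moment (Suc j) k) = 0"
    by simp
  thus ?thesis by (simp add: field_simps)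
qed

text \<open>The recursion lowers both exponents together. Equal exponents descend to the total mass
  1; unequal ones meet the factor 0, if necessary after a conjugation that swaps the
  exponents.\<close>

lemma fock_moment_eq: "fock_moment j k = (if j = k then of_real (fact k / pi ^ k) else 0)"
proof (induction j arbitrary: k)
  case 0
  show ?case
  proof (cases k)
    case (Suc m)
    have "fock_moment 0 k = (\<integral>z. cnj (fock_monom k 0 z) \<partial>lborel)"
      by (simp add: fock_monom_def)
    also have "\<dots> = cnj (fock_moment k 0)" by simp
    finally show ?thesis using fock_moment_Suc[of m 0] Suc by simp
  qed (use fock_moment_0_0 in simp)
next
  case (Suc j)
  show ?case
    by (cases k) (auto simp: fock_moment_Suc Suc.IH field_simps)
qed

text \<open>Only the diagonal of the expanded square survives integration. Together with the second
  part of \<open>hermite_sum_gabor\<close> this gives equality of the norms of \<open>f\<close> and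
  its polynomial.\<close>

lemma fock_polynomial:
  fixes c :: "nat \<Rightarrow> complex" and n :: nat
  defines "F \<equiv> \<lambda>z. \<Sum>k\<le>n. c k * z ^ k"
  shows "F \<in> fock_space" "(fock_norm F)\<^sup>2 = (\<Sum>k\<le>n. (cmod (c k))\<^sup>2 * (fact k / pi ^ k))"
proof -
  let ?w = "\<lambda>z. (cmod (F z))\<^sup>2 * exp (- pi * (cmod z)\<^sup>2)"
  have eq: "complex_of_real (?w z) = (\<Sum>j\<le>n. \<Sum>k\<le>n. c j * cnj (c k) * fock_monom j k z)" for z
  proof -
    have "complex_of_real (?w z) = F z * cnj (F z) * of_real (exp (- pi * (cmod z)\<^sup>2))"
      by (simp only: of_real_mult complex_norm_square)
    also have "\<dots> = (\<Sum>j\<le>n. \<Sum>k\<le>n. c j * cnj (c k) * fock_monom j k z)"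
      unfolding F_def cnj_sum sum_product unfolding sum_distrib_right
      by (intro sum.cong refl) (simp add: fock_monom_def mult_ac)
    finally show ?thesis .
  qed
  have "integrable lborel (\<lambda>z. complex_of_real (?w z))"
    unfolding eq by simp
  hence int: "integrable lborel ?w"
    by (rule complex_of_real_integrable_eq[THEN iffD1])
  thus "F \<in> fock_space"
    unfolding fock_space_def F_def by (auto intro!: holomorphic_intros)
  have "complex_of_real (\<integral>z. ?w z \<partial>lborel) = (\<Sum>j\<le>n. \<Sum>k\<le>n. c j * cnj (c k) * fock_moment j k)"
    unfolding integral_complex_of_real[symmetric] eq by simp
  also have "\<dots> = of_real (\<Sum>k\<le>n. (cmod (c k))\<^sup>2 * (fact k / pi ^ k))"
    by (simp add: fock_moment_eq if_distrib cong: if_cong) (simp add: complex_norm_square[symmetric])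
  finally have "(\<integral>z. ?w z \<partial>lborel) = (\<Sum>k\<le>n. (cmod (c k))\<^sup>2 * (fact k / pi ^ k))"
    by (simp only: of_real_eq_iff)
  thus "(fock_norm F)\<^sup>2 = (\<Sum>k\<le>n. (cmod (c k))\<^sup>2 * (fact k / pi ^ k))"
    unfolding fock_norm_def by (simp add: sum_nonneg)
qed

section \<open>Truncated sampling\<close>

text \<open>Each of the \<open>m\<close> extra factors is at most \<open>k + m\<close>. This
  controls how multiplication by \<open>z ^ m\<close> enlarges the Fock norm.\<close>

lemma fact_add_le: "fact (k + m) \<le> (fact k :: real) * real (k + m) ^ m"
proof (induction m)
  case (Suc m)
  have "fact (k + Suc m) = real (k + Suc m) * fact (k + m)" by simp
  also have "\<dots> \<le> real (k + Suc m) * (fact k * real (k + Suc m) ^ m)"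
    by (intro mult_left_mono order.trans[OF Suc.IH] power_mono) auto
  finally show ?case by (simp add: mult_ac)
qed simp

text \<open>At the omitted points \<open>(pi * |z|^2 / r) ^ m\<close> is at least 1, so inserting it
  as a weight bounds the tail by \<open>(pi / r) ^ m\<close> times the full sampling sum of
  \<open>z ^ m * F\<close>. The exponent \<open>m\<close> stays free here.\<close>

lemma sampling_tail:
  fixes c :: "nat \<Rightarrow> complex" and n m :: nat
  defines "F \<equiv> \<lambda>z. \<Sum>k\<le>n. c k * z ^ k"
  defines "w \<equiv> \<lambda>G z. (cmod (G z))\<^sup>2 * exp (- pi * (cmod z)\<^sup>2)"
  assumes upper: "\<And>f. f \<in> fock_space \<Longrightarrow> w f summable_on \<Lambda> \<and> infsum (w f) \<Lambda> \<le> B * (fock_norm f)\<^sup>2"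
    and "B > 0" "r > 0"
  shows "infsum (w F) {z\<in>\<Lambda>. pi * (cmod z)\<^sup>2 > r} \<le> B * (real (n + m) / r) ^ m * (fock_norm F)\<^sup>2"
proof -
  \<comment> \<open>Coefficients of \<open>z ^ m * F\<close>.\<close>
  define d where "d = (\<lambda>k. if k < m then 0 else c (k - m))"
  define G where "G = (\<lambda>z. \<Sum>k\<le>n+m. d k * z ^ k)"
  have shift: "(\<Sum>k\<le>n+m. h k) = (\<Sum>k\<le>n. h (k + m))" if "\<And>k. k < m \<Longrightarrow> h k = 0"
    for h :: "nat \<Rightarrow> 'b::comm_monoid_add"
  proof -
    have "(\<Sum>k\<le>n. h (k + m)) = sum h {m..n+m}"
      by (rule sum.reindex_bij_witness[of _ "\<lambda>k. k - m" "\<lambda>k. k + m"]) auto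
    also have "\<dots> = (\<Sum>k\<le>n+m. h k)"
      using that by (intro sum.mono_neutral_left) auto
    finally show ?thesis ..
  qed
  have G: "G z = z ^ m * F z" for z
    unfolding G_def F_def by (subst shift) (auto simp: d_def power_add sum_distrib_left mult_ac)
  have F_in: "F \<in> fock_space" and G_in: "G \<in> fock_space"
    unfolding F_def G_def by (rule fock_polynomial)+
  have "(fock_norm G)\<^sup>2 = (\<Sum>k\<le>n. (cmod (c k))\<^sup>2 * (fact (k + m) / pi ^ (k + m)))"
    unfolding G_def fock_polynomial by (subst shift) (auto simp: d_def)
  also have "\<dots> \<le> (\<Sum>k\<le>n. (cmod (c k))\<^sup>2 * (fact k / pi ^ k) * (real (n + m) / pi) ^ m)"
  proof (rule sum_mono)
    fix k assume "k \<in> {..n}"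
    have "fact (k + m) \<le> (fact k :: real) * real (k + m) ^ m" by (rule fact_add_le)
    also have "\<dots> \<le> fact k * real (n + m) ^ m"
      using \<open>k \<in> {..n}\<close> by (intro mult_left_mono power_mono) auto
    finally have "fact (k + m) / pi ^ (k + m) \<le> fact k * real (n + m) ^ m / pi ^ (k + m)"
      by (intro divide_right_mono) auto
    thus "(cmod (c k))\<^sup>2 * (fact (k + m) / pi ^ (k + m)) \<le> (cmod (c k))\<^sup>2 * (fact k / pi ^ k) * (real (n + m) / pi) ^ m"
      unfolding mult.assoc by (intro mult_left_mono) (simp_all add: power_add power_divide)
  qed
  also have "\<dots> = (real (n + m) / pi) ^ m * (fock_norm F)\<^sup>2"
    unfolding F_def fock_polynomial sum_distrib_left by (simp add: mult_ac)
  finally have norm_G: "(fock_norm G)\<^sup>2 \<le> (real (n + m) / pi) ^ m * (fock_norm F)\<^sup>2" .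
  let ?T = "{z\<in>\<Lambda>. pi * (cmod z)\<^sup>2 > r}"
  have "infsum (w F) ?T \<le> infsum (\<lambda>z. (pi / r) ^ m * w G z) \<Lambda>"
  proof (rule infsum_mono_neutral)
    show "w F summable_on ?T"
      using upper[OF F_in] by (auto intro: summable_on_subset_banach)
    show "(\<lambda>z. (pi / r) ^ m * w G z) summable_on \<Lambda>"
      using upper[OF G_in] by (intro summable_on_cmult_right) auto
    fix z assume "z \<in> ?T \<inter> \<Lambda>"
    hence "1 \<le> (pi / r * (cmod z)\<^sup>2) ^ m"
      using \<open>r > 0\<close> by (intro one_le_power) (auto simp: field_simps)
    hence "1 * w F z \<le> (pi / r * (cmod z)\<^sup>2) ^ m * w F z"
      by (intro mult_right_mono) (auto simp: w_def)
    also have "\<dots> = (pi / r) ^ m * w G z"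
      unfolding w_def G norm_mult norm_power power_mult_distrib by (simp add: power_commutes power_mult[symmetric] mult.commute)
    finally show "w F z \<le> (pi / r) ^ m * w G z" by simp
  qed (use \<open>r > 0\<close> in \<open>auto simp: w_def\<close>)
  also have "\<dots> = (pi / r) ^ m * infsum (w G) \<Lambda>"
    by (rule infsum_cmult_right')
  also have "\<dots> \<le> (pi / r) ^ m * (B * ((real (n + m) / pi) ^ m * (fock_norm F)\<^sup>2))"
  proof (rule mult_left_mono)
    have "infsum (w G) \<Lambda> \<le> B * (fock_norm G)\<^sup>2" using upper[OF G_in] by blast
    also have "\<dots> \<le> B * ((real (n + m) / pi) ^ m * (fock_norm F)\<^sup>2)"
      using norm_G \<open>B > 0\<close> by (intro mult_left_mono) auto
    finally show "infsum (w G) \<Lambda> \<le> B * ((real (n + m) / pi) ^ m * (fock_norm F)\<^sup>2)" .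
  qed (use \<open>r > 0\<close> in simp)
  also have "\<dots> = B * (real (n + m) / r) ^ m * (fock_norm F)\<^sup>2"
    by (simp add: power_divide)
  finally show ?thesis .
qed

text \<open>For \<open>m\<close> of order \<open>sqrt n\<close>, the base lies below 1 by a relative
  amount of order \<open>1 / sqrt n\<close> once \<open>\<tau> > 2\<close>; the \<open>m\<close>-th
  power accumulates this into a gain uniform in \<open>n\<close>.\<close>

lemma tail_constant:
  fixes n :: nat and \<tau> :: real
  assumes "n \<ge> 1" "\<tau> \<ge> 2"
  obtains m :: nat where "(real (n + m) / (real n + sqrt (real n) * \<tau>)) ^ m \<le> 3 / (\<tau> + 1)"
proof -
  define s where "s = sqrt (real n)"
  have s: "s \<ge> 1" "real n = s * s" using assms by (auto simp: s_def)
  define m where "m = nat \<lceil>s\<rceil>"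
  have "real_of_int \<lceil>s\<rceil> < s + 1" "s \<le> real_of_int \<lceil>s\<rceil>" by linarith+
  hence m: "s \<le> real m" "real m \<le> 2 * s" using s by (auto simp: m_def)
  \<comment> \<open>Chosen so that \<open>1 + u = (s + \<tau>) / (s + 2)\<close>, the reciprocal of
    the bound for the base that follows from \<open>m \<le> 2 * s\<close>.\<close>
  define u where "u = (\<tau> - 2) / (s + 2)"
  have u: "u \<ge> 0" using assms s by (simp add: u_def)
  have "1 + (\<tau> - 2) / 3 \<le> 1 + s * u"
  proof -
    \<comment> \<open>From \<open>s \<ge> 1\<close>; this is where the dependence on
      \<open>n\<close> disappears.\<close>
    have "(\<tau> - 2) * (s + 2) \<le> (\<tau> - 2) * (3 * s)" using assms s by (intro mult_left_mono) auto
    thus ?thesis using s by (simp add: u_def field_simps)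
  qed
  also have "\<dots> \<le> 1 + real m * u" using m u by (simp add: mult_right_mono)
  also have "\<dots> \<le> (1 + u) ^ m" using u by (intro Bernoulli_inequality) auto
  finally have lower: "(\<tau> + 1) / 3 \<le> (1 + u) ^ m" by (simp add: field_simps)
  have "real (n + m) / (real n + s * \<tau>) \<le> (s * s + 2 * s) / (s * s + s * \<tau>)"
    using m s assms by (auto intro!: divide_right_mono)
  also have "\<dots> = (s * (s + 2)) / (s * (s + \<tau>))" by (simp add: algebra_simps)
  also have "\<dots> = (s + 2) / (s + \<tau>)" using s by simp
  also have "\<dots> = 1 / (1 + u)"
    using s assms by (simp add: u_def field_simps)
  finally have "(real (n + m) / (real n + s * \<tau>)) ^ m \<le> (1 / (1 + u)) ^ m"
    using s assms by (intro power_mono) auto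
  also have "\<dots> = 1 / (1 + u) ^ m" by (simp add: power_divide)
  also have "\<dots> \<le> 1 / ((\<tau> + 1) / 3)" using lower assms by (intro divide_left_mono) (auto intro!: mult_pos_pos)
  finally show thesis using that[of m] by (simp add: s_def)
qed

theorem theorem1p3:
  fixes \<Lambda> :: "complex set"
  assumes "fock_sampling_set \<Lambda>"
  shows "\<exists>\<tau>\<^sub>0>0. \<forall>\<tau>::real. \<tau> \<ge> \<tau>\<^sub>0 \<longrightarrow>
           (\<exists>A>0. \<exists>B>0. \<exists>n\<^sub>0::nat. \<forall>n\<ge>n\<^sub>0.
              frame_with_bounds (hermite_space n)
                {z\<in>\<Lambda>. pi * (cmod z)\<^sup>2 \<le> real n + sqrt (real n) * \<tau>}
                (\<lambda>z. tf_shift z (hermite 0)) A B)"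
proof -
  define w :: "(complex \<Rightarrow> complex) \<Rightarrow> complex \<Rightarrow> real"
    where "w = (\<lambda>G z. (cmod (G z))\<^sup>2 * exp (- pi * (cmod z)\<^sup>2))"
  obtain A B where AB: "A > 0" "B > 0"
    and samp: "\<And>f. f \<in> fock_space \<Longrightarrow> w f summable_on \<Lambda> \<and> A * (fock_norm f)\<^sup>2 \<le> infsum (w f) \<Lambda> \<and>
      infsum (w f) \<Lambda> \<le> B * (fock_norm f)\<^sup>2"
    using assms unfolding fock_sampling_set_def w_def by blast
  \<comment> \<open>The 2 is required by \<open>tail_constant\<close>; \<open>6 * B / A\<close>
    makes the tail factor \<open>3 * B / (\<tau> + 1)\<close> at most \<open>A / 2\<close>, so half
    of the lower sampling bound survives.\<close>
  define \<tau>\<^sub>0 where "\<tau>\<^sub>0 = max 2 (6 * B / A)"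
  have "frame_with_bounds (hermite_space n) {z\<in>\<Lambda>. pi * (cmod z)\<^sup>2 \<le> real n + sqrt (real n) * \<tau>}
      (\<lambda>z. tf_shift z (hermite 0)) (A / 2) B" if \<tau>: "\<tau> \<ge> \<tau>\<^sub>0" and n: "n \<ge> 1" for \<tau> :: real and n :: nat
    unfolding frame_with_bounds_def
  proof (rule ballI)
    fix f assume "f \<in> hermite_space n"
    then obtain a where f: "f = (\<lambda>t. \<Sum>k\<le>n. a k * hermite k t)"
      by (rule hermite_space_obtain)
    define c where "c = (\<lambda>k. cnj (a k) * of_real ((- 2 * pi) ^ k / sqrt (sqrt 2 * hermite_sqnorm k)))"
    define F where "F = (\<lambda>z. \<Sum>k\<le>n. c k * z ^ k)"
    have gabor: "(\<lambda>z. (cmod (L2_inner f (tf_shift z (hermite 0))))\<^sup>2) = w F"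
      unfolding f F_def c_def w_def by (rule ext, rule hermite_sum_gabor)
    have norm: "(L2_norm f)\<^sup>2 = (fock_norm F)\<^sup>2"
      unfolding f F_def L2_norm_hermite_sum fock_polynomial c_def hermite_sum_gabor ..
    have "F \<in> fock_space" unfolding F_def by (rule fock_polynomial)
    note sampF = samp[OF this]
    define r where "r = real n + sqrt (real n) * \<tau>"
    have "\<tau> \<ge> 2" "6 * B / A \<le> \<tau>" using \<tau> by (auto simp: \<tau>\<^sub>0_def)
    have "r > 0" using n \<open>\<tau> \<ge> 2\<close> by (simp add: r_def add_pos_nonneg)
    let ?I = "{z\<in>\<Lambda>. pi * (cmod z)\<^sup>2 \<le> r}" and ?T = "{z\<in>\<Lambda>. pi * (cmod z)\<^sup>2 > r}"
    have sum: "w F summable_on ?I" "w F summable_on ?T"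
      using sampF by (auto intro: summable_on_subset_banach)
    have nonneg: "w F z \<ge> 0" for z by (simp add: w_def)
    obtain m where m: "(real (n + m) / r) ^ m \<le> 3 / (\<tau> + 1)"
      using tail_constant[OF n \<open>\<tau> \<ge> 2\<close>] unfolding r_def by blast
    have "infsum (w F) ?T \<le> B * (real (n + m) / r) ^ m * (fock_norm F)\<^sup>2"
      unfolding F_def w_def
      by (rule sampling_tail) (use samp AB \<open>r > 0\<close> in \<open>auto simp: w_def\<close>)
    also have "\<dots> \<le> A / 2 * (fock_norm F)\<^sup>2"
    proof (rule mult_right_mono)
      have "B * (real (n + m) / r) ^ m \<le> B * (3 / (\<tau> + 1))"
        using m AB by (intro mult_left_mono) auto
      also have "\<dots> \<le> A / 2"
        using \<open>6 * B / A \<le> \<tau>\<close> \<open>\<tau> \<ge> 2\<close> AB by (simp add: field_simps)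
      finally show "B * (real (n + m) / r) ^ m \<le> A / 2" .
    qed simp
    finally have tail: "infsum (w F) ?T \<le> A / 2 * (fock_norm F)\<^sup>2" .
    \<comment> \<open>Subtracting the tail from the full sum gives the lower bound; nonnegativity of
      the tail gives the upper one.\<close>
    have "\<Lambda> = ?I \<union> ?T" by auto
    hence "infsum (w F) \<Lambda> = infsum (w F) ?I + infsum (w F) ?T"
      using infsum_Un_disjoint[OF sum] by (metis (no_types, lifting) Int_emptyI mem_Collect_eq not_le)
    moreover have "infsum (w F) ?T \<ge> 0" by (intro infsum_nonneg nonneg)
    ultimately have "A / 2 * (fock_norm F)\<^sup>2 \<le> infsum (w F) ?I" "infsum (w F) ?I \<le> B * (fock_norm F)\<^sup>2"
      using tail sampF by auto
    thus "(\<lambda>z. (cmod (L2_inner f (tf_shift z (hermite 0))))\<^sup>2) summable_on {z\<in>\<Lambda>. pi * (cmod z)\<^sup>2 \<le> real n + sqrt (real n) * \<tau>} \<and>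
      A / 2 * (L2_norm f)\<^sup>2 \<le> (\<Sum>\<^sub>\<infinity>z\<in>{z\<in>\<Lambda>. pi * (cmod z)\<^sup>2 \<le> real n + sqrt (real n) * \<tau>}. (cmod (L2_inner f (tf_shift z (hermite 0))))\<^sup>2) \<and>
      (\<Sum>\<^sub>\<infinity>z\<in>{z\<in>\<Lambda>. pi * (cmod z)\<^sup>2 \<le> real n + sqrt (real n) * \<tau>}. (cmod (L2_inner f (tf_shift z (hermite 0))))\<^sup>2) \<le> B * (L2_norm f)\<^sup>2"
      unfolding gabor norm r_def[symmetric] using sum(1) by blast
  qed
  moreover have "\<tau>\<^sub>0 > 0" "A / 2 > 0" using AB by (auto simp: \<tau>\<^sub>0_def)
  ultimately show ?thesis using \<open>B > 0\<close> by blast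
qed

end
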